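(* Let $0<\kappa<1$, let $v>0$, $p\in\mathbb R^n$ ($n\ge 2$), let $Y=Y(0,v,p)$ be the refracted direction at $x=0$, and let $t>0$ be such that $Z=v e_{n+1}+tY\in\Sigma$ (notation in the context; for a refractor $\rho$ one takes $v=\rho(0)$, $p=\nabla\rho(0)$, $Z=Z(0)\in\mathscr V$). Suppose $y_{n+1}>0$, $\psi^{n+1}(Z)>0$, $\nabla\psi(Z)\cdot Y>0$ and $\operatorname{dist}(\mathscr U,\mathscr V)>0$. Suppose further that $\Sigma$ is a concave graph in the direction $Y$ near $Z$, i.e. in orthonormal coordinates $\hat x_1,\dots,\hat x_{n+1}$ of $\mathbb R^{n+1}$ with the $\hat x_{n+1}$-axis pointing in the direction $Y$, $\Sigma$ is given near $Z$ by $\hat x_{n+1}=\varphi(\hat x_1,\dots,\hat x_n)$ with $\varphi$ smooth and concave. Then the MTW condition holds at $x=0$: for all nonzero orthogonal vectors $\xi,\eta\in\mathbb R^n$, $$\sum_{l,m=1}^nH_{lm}\,\eta_l\eta_m<0 .$$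
   Context: $\mathscr U$ is an open subset of the upper unit hemisphere of $\mathbb R^{n+1}$ containing $e_{n+1}=(0,\dots,0,1)$; $\Sigma=\{\psi=0\}\subset\mathbb R^{n+1}$ is a regular hypersurface with $\psi$ smooth, $\psi^{n+1}=\partial\psi/\partial z_{n+1}$, and $\mathscr V\subset\Sigma$ is relatively open. $\kappa=n_1/n_2$ is the ratio of refractive indices of the media containing the source (the origin) and the target $\Sigma$. At $x=0$, i.e. for the ray from the origin in direction $e_{n+1}$ hitting at $ve_{n+1}$ a refracting surface with radial function having value $v$ and gradient $p$ at $x=0$, set $$q(p)=\sqrt{v^2+(1-\kappa^2)|p|^2},\qquad Y(0,v,p)=(y,y_{n+1})=\kappa e_{n+1}+\frac{\kappa^2-1}{\kappa v+q}\big((p,0)-v e_{n+1}\big),$$ the unit direction of the refracted ray. With $v$ fixed, the stretch function $t=t(p)>0$ is the smooth function of $p$, with the given value at the given $p$, determined near it by $\psi(ve_{n+1}+tY(0,v,p))=0$ (implicit function theorem, as $\nabla\psi\cdot Y\ne0$). For $\xi\in\mathbb R^n$, $$H_{lm}=\Big(\frac{v|\xi|^2}{\kappa^2-1}-\frac{(p\cdot\xi)^2}{v}\Big)\frac{\partial^2}{\partial p_l\partial p_m}\Big(\frac{\kappa v+q}{t}\Big)+\frac{\kappa|\xi|^2}{\kappa^2-1}\,\frac{\partial^2q}{\partial p_l\partial p_m}.$$ (For $\xi\perp\eta$, $\sum H_{lm}\eta_l\eta_m$ equals $\sum_{i,j,l,m}\frac{\partial^2(I_{ij}+II_{ij})}{\partial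 p_l\partial p_m}\xi_i\xi_j\eta_l\eta_m$, where $D^2\rho+I+II$ is the matrix in the Monge–Ampère type equation satisfied by $\rho$ at $x=0$.) *)

theory Defs
  imports "HOL-Analysis.Analysis"
begin

text \<open>
  Euclidean space of dimension \<open>n + 1\<close> is rendered as the product of \<open>real ^ 'n\<close> with \<open>real\<close>
  (whose inner product and norm are the Euclidean ones), the second factor being the last coordinate.
\<close>

abbreviation e_last :: "(real ^ 'n) \<times> real" where
  "e_last \<equiv> (0, 1)"

definition partial :: "'a::real_normed_vector \<Rightarrow> ('a \<Rightarrow> real) \<Rightarrow> 'a \<Rightarrow> real" where
  "partial b f x = deriv (\<lambda>s. f (x + s *\<^sub>R b)) 0"

definition partial2 :: "'n \<Rightarrow> 'n \<Rightarrow> (real ^ 'n::finite \<Rightarrow> real) \<Rightarrow> real ^ 'n \<Rightarrow> real" where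
  "partial2 l m f p = partial (axis l 1) (partial (axis m 1) f) p"

definition grad :: "('a::real_inner \<Rightarrow> real) \<Rightarrow> 'a \<Rightarrow> 'a" where
  "grad f x = (THE D. GDERIV f x :> D)"

text \<open>The following two definitions are meant for open sets \<open>S\<close>.\<close>

primrec times_differentiable_on ::
    "nat \<Rightarrow> 'a::real_normed_vector set \<Rightarrow> ('a \<Rightarrow> real) \<Rightarrow> bool" where
  "times_differentiable_on 0 S f \<longleftrightarrow> continuous_on S f"
| "times_differentiable_on (Suc k) S f \<longleftrightarrow>
     (\<forall>x\<in>S. f differentiable (at x)) \<and>
     (\<forall>u. times_differentiable_on k S (\<lambda>x. frechet_derivative f (at x) u))"

definition smooth_on :: "'a::real_normed_vector set \<Rightarrow> ('a \<Rightarrow> real) \<Rightarrow> bool" where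
  "smooth_on S f \<longleftrightarrow> (\<forall>k. times_differentiable_on k S f)"

definition upper_hemisphere :: "((real ^ 'n) \<times> real) set" where
  "upper_hemisphere = {x. norm x = 1 \<and> snd x > 0}"

definition zero_set :: "('a \<Rightarrow> real) \<Rightarrow> 'a set" where
  "zero_set \<psi> = {z. \<psi> z = 0}"

definition regular_hypersurface_fun :: "('a::real_inner \<Rightarrow> real) \<Rightarrow> bool" where
  "regular_hypersurface_fun \<psi> \<longleftrightarrow> smooth_on UNIV \<psi> \<and> (\<forall>z\<in>zero_set \<psi>. grad \<psi> z \<noteq> 0)"

definition q_fun :: "real \<Rightarrow> real \<Rightarrow> real ^ 'n \<Rightarrow> real" where
  "q_fun \<kappa> v p = sqrt (v\<^sup>2 + (1 - \<kappa>\<^sup>2) * (norm p)\<^sup>2)"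

definition refr_dir :: "real \<Rightarrow> real \<Rightarrow> real ^ 'n \<Rightarrow> (real ^ 'n) \<times> real" where
  "refr_dir \<kappa> v p =
     \<kappa> *\<^sub>R e_last + ((\<kappa>\<^sup>2 - 1) / (\<kappa> * v + q_fun \<kappa> v p)) *\<^sub>R ((p, 0) - v *\<^sub>R e_last)"

text \<open>
  \<open>T\<close> is a smooth positive solution of the implicit equation near \<open>p\<close>, with value \<open>t\<close> at \<open>p\<close>.
  Where the gradient of \<open>\<psi>\<close> is transversal to the refracted ray, such a \<open>T\<close> exists and its germ
  at \<open>p\<close> is unique; its values away from \<open>p\<close> are irrelevant.
\<close>

definition stretch_function ::
    "((real ^ 'n) \<times> real \<Rightarrow> real) \<Rightarrow> real \<Rightarrow> real \<Rightarrow> real ^ 'n \<Rightarrow> real \<Rightarrow>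
     (real ^ 'n \<Rightarrow> real) \<Rightarrow> bool" where
  "stretch_function \<psi> \<kappa> v p t T \<longleftrightarrow>
     T p = t \<and>
     (\<exists>W. open W \<and> p \<in> W \<and> smooth_on W T \<and>
        (\<forall>p'\<in>W. T p' > 0 \<and> \<psi> (v *\<^sub>R e_last + T p' *\<^sub>R refr_dir \<kappa> v p') = 0))"

definition H_mat ::
    "real \<Rightarrow> real \<Rightarrow> (real ^ 'n \<Rightarrow> real) \<Rightarrow> real ^ 'n \<Rightarrow> real ^ 'n \<Rightarrow> 'n::finite \<Rightarrow> 'n \<Rightarrow> real" where
  "H_mat \<kappa> v T p \<xi> l m =
     (v * (norm \<xi>)\<^sup>2 / (\<kappa>\<^sup>2 - 1) - (p \<bullet> \<xi>)\<^sup>2 / v) *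
       partial2 l m (\<lambda>p'. (\<kappa> * v + q_fun \<kappa> v p') / T p') p +
     \<kappa> * (norm \<xi>)\<^sup>2 / (\<kappa>\<^sup>2 - 1) * partial2 l m (q_fun \<kappa> v) p"

text \<open>
  An orthonormal coordinate system whose last axis points in the (unit) direction \<open>Y\<close> is given by an
  orthogonal map \<open>A\<close> taking \<open>e_last\<close> to \<open>Y\<close>: the point with coordinates \<open>(x', x\<^sub>n\<^sub>+\<^sub>1)\<close> is
  \<open>A (x', x\<^sub>n\<^sub>+\<^sub>1)\<close>. Convexity of \<open>D\<close> is part of \<open>concave_on\<close>.
\<close>

definition concave_graph_near ::
    "((real ^ 'n) \<times> real) set \<Rightarrow> (real ^ 'n) \<times> real \<Rightarrow> (real ^ 'n) \<times> real \<Rightarrow> bool" where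
  "concave_graph_near S Y Z \<longleftrightarrow>
     (\<exists>(A :: (real ^ 'n) \<times> real \<Rightarrow> (real ^ 'n) \<times> real) D \<phi> N.
        orthogonal_transformation A \<and> A e_last = Y \<and>
        open D \<and> smooth_on D \<phi> \<and> concave_on D \<phi> \<and>
        open N \<and> Z \<in> N \<and>
        (\<forall>x' x\<^sub>n. A (x', x\<^sub>n) \<in> N \<longrightarrow>
           x' \<in> D \<and> (A (x', x\<^sub>n) \<in> S \<longleftrightarrow> x\<^sub>n = \<phi> x')))"

end

theory Submission
  imports Defs
begin

text \<open>
  Put \<open>F = (\<kappa>v + q) / T\<close> and \<open>P(p') = (-(1 - \<kappa>\<^sup>2)p', v + \<kappa>q(p'))\<close>. Then the target point of \<open>p'\<close> is
  \<open>v e\<^sub>n\<^sub>+\<^sub>1 + P(p') / F(p')\<close>: in these projective terms the stretch function enters only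
  through \<open>F\<close>. Concavity of \<open>\<Sigma>\<close> along \<open>Y\<close> says that \<open>\<Sigma>\<close> lies locally on the side
  \<open>\<nabla>\<psi>(Z) \<bullet> (z - Z) \<le> 0\<close> of its tangent plane, that is \<open>F \<ge> \<nabla>\<psi>(Z) \<bullet> P / c\<close> with
  \<open>c = t \<nabla>\<psi>(Z) \<bullet> Y > 0\<close> and equality at \<open>p\<close>. Comparing second derivatives in direction \<open>\<eta>\<close>
  gives \<open>F\<^sub>\<eta>\<^sub>\<eta> \<ge> \<kappa> \<psi>\<^sup>n\<^sup>+\<^sup>1(Z) q\<^sub>\<eta>\<^sub>\<eta> / c\<close>, and \<open>q\<^sub>\<eta>\<^sub>\<eta> > 0\<close> by Cauchy--Schwarz. Both coefficients in \<open>H\<close> are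
  negative.
\<close>

section \<open>Directional, partial and second derivatives\<close>

lemma has_real_derivative_along_line:
  fixes f :: "'a::real_normed_vector \<Rightarrow> real"
  assumes "(f has_derivative D) (at (x + s *\<^sub>R b))"
  shows "((\<lambda>s. f (x + s *\<^sub>R b)) has_real_derivative D b) (at s)"
proof -
  have "((\<lambda>s. x + s *\<^sub>R b) has_derivative (\<lambda>h. h *\<^sub>R b)) (at s)"
    by (auto intro!: derivative_eq_intros)
  from has_derivative_compose [OF this assms]
  have "((\<lambda>s. f (x + s *\<^sub>R b)) has_derivative (\<lambda>h. D (h *\<^sub>R b))) (at s)" .
  moreover have "D (h *\<^sub>R b) = D b * h" for h
    using linear_cmul [OF has_derivative_linear [OF assms]] by simp
  ultimately show ?thesis
    by (simp add: has_field_derivative_def)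
qed

lemma partial_eq:
  assumes "(f has_derivative D) (at x)"
  shows "partial b f x = D b"
  unfolding partial_def
  using has_real_derivative_along_line [where s = 0 and b = b] assms
  by (simp add: DERIV_imp_deriv)

lemma line_in_open:
  fixes p b :: "'a::real_normed_vector"
  assumes "open W" "p \<in> W"
  obtains d where "d > 0" "\<And>s. \<bar>s\<bar> < d \<Longrightarrow> p + s *\<^sub>R b \<in> W"
proof -
  have "isCont (\<lambda>s. p + s *\<^sub>R b) 0"
    by (intro continuous_intros)
  then have "\<forall>\<^sub>F s in nhds 0. p + s *\<^sub>R b \<in> W"
    using assms topological_tendstoD [of "\<lambda>s. p + s *\<^sub>R b" p "nhds 0" W]
    by (simp add: continuous_at tendsto_nhds_iff)
  then show thesis
    using that by (auto simp: eventually_nhds_metric dist_real_def)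
qed

text \<open>The outer \<open>deriv\<close> samples the inner partial derivative at points around
  \<open>p\<close>, so the first derivative is prescribed on a whole neighbourhood, the second one
  only at \<open>p\<close>.\<close>

lemma partial2_eq:
  fixes f :: "real ^ 'n::finite \<Rightarrow> real"
  assumes W: "open W" "p \<in> W"
    and D: "\<And>x. x \<in> W \<Longrightarrow> (f has_derivative D x) (at x)"
    and E: "((\<lambda>x. D x (axis m 1)) has_derivative E) (at p)"
  shows "partial2 l m f p = E (axis l 1)"
proof -
  have "((\<lambda>x. partial (axis m 1) f x) has_derivative E) (at p)"
    by (rule has_derivative_transform_within_open [OF E W]) (simp add: partial_eq [OF D])
  then show ?thesis
    unfolding partial2_def by (rule partial_eq)
qed

lemma linear_axis_expansion:
  fixes L :: "real ^ 'n::finite \<Rightarrow> real"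
  assumes "linear L"
  shows "L x = (\<Sum>i\<in>UNIV. x $ i * L (axis i 1))"
proof -
  have "L x = L (\<Sum>i\<in>UNIV. x $ i *\<^sub>R axis i 1)"
    using basis_expansion [of x] by (simp add: scalar_mult_eq_scaleR)
  also have "\<dots> = (\<Sum>i\<in>UNIV. x $ i * L (axis i 1))"
    using assms by (simp add: linear_sum linear_cmul)
  finally show ?thesis .
qed

text \<open>Turns the coordinate double sum of the MTW condition into a single second derivative
  along \<open>\<eta>\<close>, so that the comparison argument can avoid coordinates.\<close>

lemma partial2_quadratic_form:
  fixes f :: "real ^ 'n::finite \<Rightarrow> real"
  assumes W: "open W" "p \<in> W"
    and D: "\<And>x. x \<in> W \<Longrightarrow> (f has_derivative D x) (at x)"
    and E: "\<And>u. ((\<lambda>x. D x u) has_derivative E u) (at p)"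
  shows "(\<Sum>l\<in>UNIV. \<Sum>m\<in>UNIV. partial2 l m f p * \<eta> $ l * \<eta> $ m) = E \<eta> \<eta>"
proof -
  \<comment> \<open>Linearity of \<open>E\<close> in its second argument is automatic, since
    \<open>E u\<close> is a derivative. In the first argument it comes from linearity of each
    \<open>D x\<close>, carried over by uniqueness of the derivative.\<close>
  have "((\<lambda>x. \<Sum>m\<in>UNIV. \<eta> $ m * D x (axis m 1)) has_derivative
         (\<lambda>h. \<Sum>m\<in>UNIV. \<eta> $ m * E (axis m 1) h)) (at p)"
    by (intro has_derivative_sum has_derivative_mult_right E)
  then have "((\<lambda>x. D x \<eta>) has_derivative (\<lambda>h. \<Sum>m\<in>UNIV. \<eta> $ m * E (axis m 1) h)) (at p)"
    by (rule has_derivative_transform_within_open [OF _ W])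
      (metis linear_axis_expansion [OF has_derivative_linear [OF D]])
  then have E\<eta>: "E \<eta> = (\<lambda>h. \<Sum>m\<in>UNIV. \<eta> $ m * E (axis m 1) h)"
    using E has_derivative_unique by blast
  have "E \<eta> \<eta> = (\<Sum>m\<in>UNIV. \<eta> $ m * E (axis m 1) \<eta>)"
    by (simp add: E\<eta>)
  also have "\<dots> = (\<Sum>m\<in>UNIV. \<Sum>l\<in>UNIV. partial2 l m f p * \<eta> $ l * \<eta> $ m)"
    by (subst linear_axis_expansion [OF has_derivative_linear [OF E]])
      (simp add: partial2_eq [OF W D E] sum_distrib_left ac_simps)
  also have "\<dots> = (\<Sum>l\<in>UNIV. \<Sum>m\<in>UNIV. partial2 l m f p * \<eta> $ l * \<eta> $ m)"
    by (rule sum.swap)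
  finally show ?thesis ..
qed

section \<open>One-dimensional comparison arguments\<close>

lemma second_derivative_nonneg_at_min:
  fixes f :: "'a::real_normed_vector \<Rightarrow> real"
  assumes W: "open W" "p \<in> W"
    and D: "\<And>x. x \<in> W \<Longrightarrow> (f has_derivative D x) (at x)"
    and E: "((\<lambda>x. D x \<eta>) has_derivative E) (at p)"
    and min: "\<And>x. x \<in> W \<Longrightarrow> f p \<le> f x"
  shows "E \<eta> \<ge> 0"
proof (rule ccontr)
  assume "\<not> E \<eta> \<ge> 0"
  then have neg: "E \<eta> < 0"
    by simp
  obtain d where d: "d > 0" "\<And>s. \<bar>s\<bar> < d \<Longrightarrow> p + s *\<^sub>R \<eta> \<in> W"
    using line_in_open [OF W] by blast
  define g where "g s = f (p + s *\<^sub>R \<eta>)" for s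
  define h where "h s = D (p + s *\<^sub>R \<eta>) \<eta>" for s
  have g: "(g has_real_derivative h s) (at s)" if "\<bar>s\<bar> < d" for s
    unfolding g_def h_def using D d(2) that by (intro has_real_derivative_along_line) auto
  \<comment> \<open>The slope \<open>h\<close> vanishes at the minimum. If its derivative there were
    negative, it would be negative just to the right of 0, and \<open>g\<close> would drop below its
    minimum.\<close>
  have "(h has_real_derivative E \<eta>) (at 0)"
    unfolding h_def using E has_real_derivative_along_line [where s = 0 and D = E] by simp
  from DERIV_neg_dec_right [OF this neg] obtain d' where d': "d' > 0" "\<And>s. 0 < s \<Longrightarrow> s < d' \<Longrightarrow> h s < h 0"
    by auto
  have "\<forall>s. \<bar>0 - s\<bar> < d \<longrightarrow> g 0 \<le> g s"
    using min d(2) by (simp add: g_def)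
  then have h0: "h 0 = 0"
    using DERIV_local_min [OF g [of 0] d(1)] d(1) by simp
  define b where "b = min d d' / 2"
  have b: "0 < b" "b < d" "b < d'"
    using d(1) d'(1) by (auto simp: b_def)
  have "g 0 > g b"
  proof (rule DERIV_neg_imp_decreasing_open [OF b(1)])
    show "\<exists>y. (g has_real_derivative y) (at x) \<and> y < 0" if "0 < x" "x < b" for x
      using g [of x] d'(2) [of x] h0 that b by auto
    show "continuous_on {0..b} g"
      using g b by (intro DERIV_atLeastAtMost_imp_continuous_on) force
  qed
  moreover have "g 0 \<le> g b"
    using min d(2) b by (simp add: g_def)
  ultimately show False
    by simp
qed

lemma concave_on_below_tangent:
  fixes \<phi> :: "'a::real_normed_vector \<Rightarrow> real"
  assumes "concave_on D \<phi>" "x \<in> D" "y \<in> D" and L: "(\<phi> has_derivative L) (at x)"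
  shows "\<phi> y \<le> \<phi> x + L (y - x)"
proof (rule ccontr)
  assume "\<not> ?thesis"
  then have neg: "L (y - x) - (\<phi> y - \<phi> x) < 0"
    by simp
  \<comment> \<open>After subtraction of the linear growth of the chord, concavity keeps
    \<open>h\<close> at or above \<open>h 0\<close> between 0 and 1, whereas a failure of the
    tangent bound makes \<open>h\<close> decrease initially.\<close>
  define h where "h s = \<phi> (x + s *\<^sub>R (y - x)) - s * (\<phi> y - \<phi> x)" for s
  have "(h has_real_derivative L (y - x) - (\<phi> y - \<phi> x)) (at 0)"
    unfolding h_def using has_real_derivative_along_line [of \<phi> L x 0 "y - x"] L
    by (auto intro!: derivative_eq_intros)
  from DERIV_neg_dec_right [OF this neg]
  obtain d where d: "d > 0" "\<And>s. 0 < s \<Longrightarrow> s < d \<Longrightarrow> h s < h 0"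
    by auto
  define s where "s = min 1 d / 2"
  have s: "0 < s" "s < d" "s < 1"
    using d(1) by (auto simp: s_def)
  have "\<phi> ((1 - s) *\<^sub>R x + s *\<^sub>R y) \<ge> (1 - s) * \<phi> x + s * \<phi> y"
    using assms s by (intro concave_onD) auto
  then have "h s \<ge> h 0"
    by (simp add: h_def algebra_simps)
  with d(2) [OF s(1,2)] show False
    by simp
qed

section \<open>Consequences of smoothness, and the gradient\<close>

lemma smooth_onD1:
  assumes "smooth_on S f" "x \<in> S"
  shows "(f has_derivative frechet_derivative f (at x)) (at x)"
proof -
  have "times_differentiable_on (Suc 0) S f"
    using assms(1) unfolding smooth_on_def by blast
  then show ?thesis
    using assms(2) frechet_derivative_works by auto
qed

lemma smooth_onD2:
  assumes "smooth_on S f" "x \<in> S"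
  shows "(\<lambda>x. frechet_derivative f (at x) u) differentiable (at x)"
proof -
  have "times_differentiable_on (Suc (Suc 0)) S f"
    using assms(1) unfolding smooth_on_def by blast
  then show ?thesis
    using assms(2) by auto
qed

text \<open>Since \<open>grad\<close> is a definite description, both existence and uniqueness of
  the representing vector are required; the vector is assembled from the values of \<open>L\<close>
  on the basis.\<close>

lemma grad_inner:
  fixes f :: "'a::euclidean_space \<Rightarrow> real"
  assumes "(f has_derivative L) (at x)"
  shows "grad f x \<bullet> h = L h"
proof -
  define D where "D = (\<Sum>b\<in>Basis. L b *\<^sub>R b)"
  have LD: "L h = h \<bullet> D" for h
  proof -
    have "L h = L (\<Sum>b\<in>Basis. (h \<bullet> b) *\<^sub>R b)"
      by (simp add: euclidean_representation)
    also have "\<dots> = h \<bullet> D"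
      using has_derivative_linear [OF assms]
      by (simp add: linear_sum linear_cmul D_def inner_sum_right mult.commute)
    finally show ?thesis .
  qed
  have "grad f x = D"
    unfolding grad_def
  proof (rule the_equality)
    have "L = (\<lambda>h. h \<bullet> D)"
      using LD by blast
    then show "GDERIV f x :> D"
      using assms by (simp add: gderiv_def)
    show "D' = D" if "GDERIV f x :> D'" for D'
    proof -
      have "(\<lambda>h. h \<bullet> D') = L"
        using that assms has_derivative_unique unfolding gderiv_def by blast
      then have "h \<bullet> D' = h \<bullet> D" for h
        using LD by metis
      then show ?thesis
        by (metis inner_commute vector_eq_rdot)
    qed
  qed
  then show ?thesis
    by (simp add: LD inner_commute)
qed

section \<open>The target lies on one side of its tangent plane\<close>

lemma concave_graph_near_tangent:
  fixes \<psi> :: "(real ^ 'n::finite) \<times> real \<Rightarrow> real"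
  assumes graph: "concave_graph_near (zero_set \<psi>) Y Z"
    and Z: "Z \<in> zero_set \<psi>"
    and L: "(\<psi> has_derivative L) (at Z)" and LY: "L Y > 0"
  obtains N where "open N" "Z \<in> N" "\<And>z. z \<in> N \<Longrightarrow> z \<in> zero_set \<psi> \<Longrightarrow> L (z - Z) \<le> 0"
proof -
  obtain A :: "(real ^ 'n) \<times> real \<Rightarrow> (real ^ 'n) \<times> real" and D \<phi> N where A: "orthogonal_transformation A" "A e_last = Y"
    and D: "open D" "smooth_on D \<phi>" "concave_on D \<phi>"
    and N: "open N" "Z \<in> N"
    and *: "\<forall>x r. A (x, r) \<in> N \<longrightarrow> x \<in> D \<and> (A (x, r) \<in> zero_set \<psi> \<longleftrightarrow> r = \<phi> x)"
    using graph unfolding concave_graph_near_def by blast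
  have linA: "linear A"
    using A(1) by (rule orthogonal_transformation_linear)
  have linL: "linear L"
    using L by (rule has_derivative_linear)
  have surjA: "surj A"
    using A(1) by (rule orthogonal_transformation_surj)
  then obtain x0 r0 where x0: "Z = A (x0, r0)"
    by (metis surjD surj_pair)
  with * N Z have x0D: "x0 \<in> D" and r0: "r0 = \<phi> x0"
    by auto
  define K where "K = frechet_derivative \<phi> (at x0)"
  have K: "(\<phi> has_derivative K) (at x0)"
    unfolding K_def using D(2) x0D by (rule smooth_onD1)
  have A': "(A has_derivative A) (at w)" for w
    using linA by (simp add: linear_conv_bounded_linear bounded_linear_imp_has_derivative)
  have dgraph: "((\<lambda>x. A (x, \<phi> x)) has_derivative (\<lambda>u. A (u, K u))) (at x0)"
    by (rule has_derivative_compose [OF _ A'])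
      (intro has_derivative_Pair has_derivative_ident K)
  \<comment> \<open>Tangent vectors of the graph are annihilated by \<open>L\<close>: near
    \<open>x0\<close> the graph stays in \<open>N\<close>, hence in the zero set, so
    \<open>\<psi>\<close> composed with the graph map is locally constant.\<close>
  have LA: "L (A (u, K u)) = 0" for u
  proof -
    have d\<psi>: "((\<lambda>x. \<psi> (A (x, \<phi> x))) has_derivative (\<lambda>u. L (A (u, K u)))) (at x0)"
      using L x0 r0 by (intro has_derivative_compose [OF dgraph]) simp
    have "\<forall>\<^sub>F x in nhds x0. \<psi> (A (x, \<phi> x)) = 0"
    proof -
      have "isCont (\<lambda>x. A (x, \<phi> x)) x0"
        using dgraph by (rule has_derivative_continuous)
      then have "\<forall>\<^sub>F x in nhds x0. A (x, \<phi> x) \<in> N"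
        using N x0 r0 topological_tendstoD [of "\<lambda>x. A (x, \<phi> x)" Z "nhds x0" N]
        by (simp add: continuous_at tendsto_nhds_iff)
      then show ?thesis
        by eventually_elim (use * in \<open>auto simp: zero_set_def\<close>)
    qed
    then obtain W where W: "open W" "x0 \<in> W" "\<And>x. x \<in> W \<Longrightarrow> \<psi> (A (x, \<phi> x)) = 0"
      unfolding eventually_nhds by blast
    have "((\<lambda>x. 0) has_derivative (\<lambda>u. L (A (u, K u)))) (at x0)"
      by (rule has_derivative_transform_within_open [OF d\<psi> W])
    from has_derivative_unique [OF this has_derivative_const] show ?thesis
      by (rule fun_cong)
  qed
  \<comment> \<open>Split the vector into a tangent vector of the graph and a multiple of the last
    axis, which \<open>A\<close> sends to \<open>Y\<close>. Thus \<open>L\<close> measures the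
    height above the tangent plane, scaled by the positive number \<open>L Y\<close>.\<close>
  have LA': "L (A (u, r)) = (r - K u) * L Y" for u r
  proof -
    have "(u, r) = (u, K u) + (r - K u) *\<^sub>R e_last"
      by simp
    then have "L (A (u, r)) = L (A ((u, K u) + (r - K u) *\<^sub>R e_last))"
      by (rule arg_cong)
    also have "\<dots> = L (A (u, K u)) + (r - K u) *\<^sub>R L (A e_last)"
      by (simp only: linear_add [OF linA] linear_cmul [OF linA]
          linear_add [OF linL] linear_cmul [OF linL])
    finally show ?thesis
      by (simp add: LA A(2))
  qed
  show thesis
  proof
    fix z assume z: "z \<in> N" "z \<in> zero_set \<psi>"
    obtain x r where xr: "z = A (x, r)"
      using surjA by (metis surjD surj_pair)
    with * z have "x \<in> D" "r = \<phi> x"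
      by auto
    with concave_on_below_tangent [OF D(3) x0D _ K, of x] have "r - r0 \<le> K (x - x0)"
      by (simp add: r0)
    moreover have "L (z - Z) = (r - r0 - K (x - x0)) * L Y"
      unfolding xr x0 by (simp add: LA' linear_diff [OF linA, symmetric])
    ultimately show "L (z - Z) \<le> 0"
      using LY by (simp add: mult_le_0_iff)
  qed (use N in auto)
qed

section \<open>The function q and the refracted direction\<close>

context
  fixes \<kappa> v :: real
  assumes \<kappa>: "0 < \<kappa>" "\<kappa> < 1" and v: "v > 0"
begin

lemma refraction_index_gap_pos: "1 - \<kappa>\<^sup>2 > 0"
  using \<kappa> by (simp add: power_less_one_iff abs_square_less_1)

lemma q_radicand_pos: "v\<^sup>2 + (1 - \<kappa>\<^sup>2) * (norm p)\<^sup>2 > 0"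
  using refraction_index_gap_pos v by (intro add_pos_nonneg) auto

lemma q_fun_pos: "q_fun \<kappa> v p > 0"
  unfolding q_fun_def using q_radicand_pos by simp

lemma q_fun_squared: "(q_fun \<kappa> v p)\<^sup>2 = v\<^sup>2 + (1 - \<kappa>\<^sup>2) * (norm p)\<^sup>2"
  unfolding q_fun_def using q_radicand_pos [of p] by simp

lemma q_fun_has_derivative:
  "(q_fun \<kappa> v has_derivative (\<lambda>u. (1 - \<kappa>\<^sup>2) * (x \<bullet> u) / q_fun \<kappa> v x)) (at x)"
proof -
  have "((\<lambda>x. sqrt (v\<^sup>2 + (1 - \<kappa>\<^sup>2) * (x \<bullet> x))) has_derivative
         (\<lambda>u. (1 - \<kappa>\<^sup>2) * (x \<bullet> u) / sqrt (v\<^sup>2 + (1 - \<kappa>\<^sup>2) * (x \<bullet> x)))) (at x)"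
    using q_radicand_pos [of x]
    by (auto intro!: derivative_eq_intros simp: power2_norm_eq_inner inner_commute field_simps)
  then show ?thesis
    by (simp add: q_fun_def [abs_def] power2_norm_eq_inner)
qed

lemma q_fun_has_second_derivative:
  "((\<lambda>x. (1 - \<kappa>\<^sup>2) * (x \<bullet> u) / q_fun \<kappa> v x) has_derivative
    (\<lambda>h. (1 - \<kappa>\<^sup>2) * (h \<bullet> u) / q_fun \<kappa> v p
         - (1 - \<kappa>\<^sup>2)\<^sup>2 * (p \<bullet> u) * (p \<bullet> h) / q_fun \<kappa> v p ^ 3)) (at p)"
  using q_fun_pos [of p]
  by (auto intro!: derivative_eq_intros q_fun_has_derivative
      simp: field_simps power2_eq_square power3_eq_cube)

text \<open>Over the common denominator \<open>q ^ 3\<close>, Cauchy-Schwarz bounds the subtracted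
  term by the part of \<open>q\<^sup>2\<close> that contains \<open>p\<close>; the remaining part
  \<open>v\<^sup>2\<close> makes the inequality strict.\<close>

lemma q_fun_second_derivative_pos:
  assumes "\<eta> \<noteq> 0"
  shows "(1 - \<kappa>\<^sup>2) * (\<eta> \<bullet> \<eta>) / q_fun \<kappa> v p
         - (1 - \<kappa>\<^sup>2)\<^sup>2 * (p \<bullet> \<eta>) * (p \<bullet> \<eta>) / q_fun \<kappa> v p ^ 3 > 0"
proof -
  define a where "a = 1 - \<kappa>\<^sup>2"
  define q where "q = q_fun \<kappa> v p"
  have a: "a > 0" and q: "q > 0"
    unfolding a_def q_def by (rule refraction_index_gap_pos q_fun_pos)+
  have "(p \<bullet> \<eta>)\<^sup>2 \<le> (p \<bullet> p) * (\<eta> \<bullet> \<eta>)"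
    by (rule Cauchy_Schwarz_ineq)
  then have "a * (p \<bullet> \<eta>)\<^sup>2 \<le> a * ((p \<bullet> p) * (\<eta> \<bullet> \<eta>))"
    using a by simp
  also have "\<dots> < v\<^sup>2 * (\<eta> \<bullet> \<eta>) + a * ((p \<bullet> p) * (\<eta> \<bullet> \<eta>))"
    using v assms by simp
  also have "\<dots> = q\<^sup>2 * (\<eta> \<bullet> \<eta>)"
    by (simp add: q_def q_fun_squared a_def power2_norm_eq_inner algebra_simps)
  finally have "a * (q\<^sup>2 * (\<eta> \<bullet> \<eta>) - a * (p \<bullet> \<eta>)\<^sup>2) / q ^ 3 > 0"
    using a q by simp
  also have "a * (q\<^sup>2 * (\<eta> \<bullet> \<eta>) - a * (p \<bullet> \<eta>)\<^sup>2) / q ^ 3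
      = a * (\<eta> \<bullet> \<eta>) / q - a\<^sup>2 * (p \<bullet> \<eta>) * (p \<bullet> \<eta>) / q ^ 3"
    using q by (simp add: field_simps power2_eq_square power3_eq_cube)
  finally show ?thesis
    by (simp add: a_def q_def)
qed

text \<open>With \<open>w\<close> the denominator, the last coordinate simplifies because
  \<open>\<kappa> * w - (\<kappa>\<^sup>2 - 1) * v\<close> equals \<open>v + \<kappa> * q\<close>.
  After \<open>1 / w\<close> is pulled out, the horizontal part is linear in \<open>p\<close> and
  only \<open>q\<close> remains nonlinear.\<close>

lemma refr_dir_eq:
  "refr_dir \<kappa> v p = (1 / (\<kappa> * v + q_fun \<kappa> v p)) *\<^sub>R
     ((- (1 - \<kappa>\<^sup>2)) *\<^sub>R p, v + \<kappa> * q_fun \<kappa> v p)"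
proof -
  define w where "w = \<kappa> * v + q_fun \<kappa> v p"
  have "w \<noteq> 0"
    using \<kappa> v q_fun_pos [of p] unfolding w_def by (metis add_pos_pos less_irrefl mult_pos_pos)
  then have "\<kappa> - (\<kappa>\<^sup>2 - 1) / w * v = (v + \<kappa> * q_fun \<kappa> v p) / w"
    by (simp add: field_simps) (simp add: w_def power2_eq_square algebra_simps)
  then show ?thesis
    by (simp add: refr_dir_def flip: w_def)
qed

end

section \<open>Comparison of second derivatives and the sign of the form\<close>

theorem theorem3:
  fixes \<kappa> v t :: real
    and p :: "real ^ 'n::finite"
    and \<psi> :: "(real ^ 'n) \<times> real \<Rightarrow> real"
    and U V :: "((real ^ 'n) \<times> real) set"
    and Y Z :: "(real ^ 'n) \<times> real"
    and T :: "real ^ 'n \<Rightarrow> real"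
  assumes "CARD('n) \<ge> 2"
    and "0 < \<kappa>" and "\<kappa> < 1" and "v > 0" and "t > 0"
    and "regular_hypersurface_fun \<psi>"
    and "openin (top_of_set upper_hemisphere) U" and "e_last \<in> U"
    and "openin (top_of_set (zero_set \<psi>)) V"
    and "Y = refr_dir \<kappa> v p"
    and "Z = v *\<^sub>R e_last + t *\<^sub>R Y" and "Z \<in> zero_set \<psi>"
    and "snd Y > 0"
    and "partial e_last \<psi> Z > 0"
    and "grad \<psi> Z \<bullet> Y > 0"
    and "V \<noteq> {} \<Longrightarrow> setdist U V > 0"
    and "concave_graph_near (zero_set \<psi>) Y Z"
    and "stretch_function \<psi> \<kappa> v p t T"
  shows "\<forall>\<xi> \<eta>. \<xi> \<noteq> 0 \<and> \<eta> \<noteq> 0 \<and> orthogonal \<xi> \<eta> \<longrightarrow>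
           (\<Sum>l\<in>UNIV. \<Sum>m\<in>UNIV. H_mat \<kappa> v T p \<xi> l m * (\<eta> $ l) * (\<eta> $ m)) < 0"
proof (intro allI impI)
  fix \<xi> \<eta> :: "real ^ 'n"
  assume "\<xi> \<noteq> 0 \<and> \<eta> \<noteq> 0 \<and> orthogonal \<xi> \<eta>"
  then have \<xi>: "\<xi> \<noteq> 0" and \<eta>: "\<eta> \<noteq> 0"
    by auto
  note \<kappa>v = assms(2-4)
  define q :: "real ^ 'n \<Rightarrow> real" where "q = q_fun \<kappa> v"
  define w where "w x = \<kappa> * v + q x" for x :: "real ^ 'n"
  define Dq where "Dq x u = (1 - \<kappa>\<^sup>2) * (x \<bullet> u) / q x" for x u :: "real ^ 'n"
  define Eq where "Eq u h = (1 - \<kappa>\<^sup>2) * (h \<bullet> u) / q p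
     - (1 - \<kappa>\<^sup>2)\<^sup>2 * (p \<bullet> u) * (p \<bullet> h) / q p ^ 3" for u h :: "real ^ 'n"
  define F where "F x = w x / T x" for x
  have Dq: "(q has_derivative Dq x) (at x)" for x
    unfolding q_def Dq_def [abs_def] by (rule q_fun_has_derivative [OF \<kappa>v])
  have Eq: "((\<lambda>x. Dq x u) has_derivative Eq u) (at p)" for u
    unfolding q_def Dq_def Eq_def [abs_def] by (rule q_fun_has_second_derivative [OF \<kappa>v])
  have Eq_pos: "Eq \<eta> \<eta> > 0"
    unfolding Eq_def q_def by (rule q_fun_second_derivative_pos [OF \<kappa>v \<eta>])
  have w_pos: "w x > 0" for x
    unfolding w_def q_def using \<kappa>v by (simp add: add_pos_pos q_fun_pos [OF \<kappa>v])

  obtain W where W: "open W" "p \<in> W" and T: "smooth_on W T"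
    and T_pos: "\<And>x. x \<in> W \<Longrightarrow> T x > 0"
    and T_zero: "\<And>x. x \<in> W \<Longrightarrow> \<psi> (v *\<^sub>R e_last + T x *\<^sub>R refr_dir \<kappa> v x) = 0"
    and Tp: "T p = t"
    using assms(18) unfolding stretch_function_def by blast
  define DT where "DT x = frechet_derivative T (at x)" for x
  have DT: "(T has_derivative DT x) (at x)" if "x \<in> W" for x
    unfolding DT_def using T that by (rule smooth_onD1)
  have DT_diff: "(\<lambda>x. DT x u) differentiable (at p)" for u
    unfolding DT_def using T W(2) by (rule smooth_onD2)
  define DF where "DF x u = (Dq x u * T x - w x * DT x u) / (T x * T x)" for x u
  have DF: "(F has_derivative DF x) (at x)" if "x \<in> W" for x
    unfolding F_def [abs_def] DF_def [abs_def] w_def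
    using T_pos [OF that] by (auto intro!: derivative_eq_intros Dq DT that)
  \<comment> \<open>The second derivative \<open>EF\<close> is obtained without a formula; its sign
    along \<open>\<eta>\<close> will come from a minimum property.\<close>
  have "(\<lambda>x. DF x u) differentiable (at p)" for u
    unfolding DF_def w_def
    using Dq Eq DT [OF W(2)] DT_diff T_pos [OF W(2)]
    by (intro differentiable_divide differentiable_diff differentiable_mult
        differentiable_add differentiable_const) (auto simp: differentiable_def)
  then obtain EF where EF: "\<And>u. ((\<lambda>x. DF x u) has_derivative EF u) (at p)"
    unfolding differentiable_def by metis

  define L where "L = frechet_derivative \<psi> (at Z)"
  have L: "(\<psi> has_derivative L) (at Z)"
    unfolding L_def using assms(6) unfolding regular_hypersurface_fun_def
    by (auto intro: smooth_onD1)
  have linL: "linear L"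
    using L by (rule has_derivative_linear)
  have Le: "L e_last > 0"
    using assms(14) by (simp add: partial_eq [OF L])
  have LY: "L Y > 0"
    using assms(15) by (simp add: grad_inner [OF L])
  define P where "P x = ((- (1 - \<kappa>\<^sup>2)) *\<^sub>R x, v + \<kappa> * q x)" for x :: "real ^ 'n"
  have TY: "T x *\<^sub>R refr_dir \<kappa> v x = (1 / F x) *\<^sub>R P x" for x
    unfolding F_def P_def w_def q_def by (simp add: refr_dir_eq [OF \<kappa>v])
  \<comment> \<open>This is \<open>L (Z - v *\<^sub>R e_last)\<close>, the level of \<open>L\<close>
    on the tangent plane at \<open>Z\<close> when measured from the point where the ray leaves the
    refractor.\<close>
  define c where "c = t * L Y"
  have c: "c > 0"
    using assms(5) LY by (simp add: c_def)
  obtain N where N: "open N" "Z \<in> N" "\<And>z. z \<in> N \<Longrightarrow> z \<in> zero_set \<psi> \<Longrightarrow> L (z - Z) \<le> 0"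
    using concave_graph_near_tangent [OF assms(17,12) L LY] by blast
  define z where "z x = v *\<^sub>R e_last + (1 / F x) *\<^sub>R P x" for x
  have zp: "z p = Z"
    using TY [of p] by (simp add: z_def assms(10,11) Tp)
  have F_pos: "F x > 0" if "x \<in> W" for x
    using w_pos T_pos [OF that] by (simp add: F_def)
  have "isCont z p"
    unfolding z_def P_def using F_pos [OF W(2)]
    by (intro continuous_intros has_derivative_continuous [OF Dq]
        has_derivative_continuous [OF DF [OF W(2)]]) auto
  then have "\<forall>\<^sub>F x in nhds p. z x \<in> N"
    using N zp topological_tendstoD [of z Z "nhds p" N]
    by (simp add: continuous_at tendsto_nhds_iff)
  then obtain W1 where W1: "open W1" "p \<in> W1" "\<And>x. x \<in> W1 \<Longrightarrow> z x \<in> N"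
    by (auto simp: eventually_nhds)
  \<comment> \<open>On \<open>W2\<close> the implicit equation holds and, by continuity of
    \<open>z\<close> at \<open>p\<close>, the target point stays where the tangent plane bound
    applies.\<close>
  define W2 where "W2 = W \<inter> W1"
  have W2: "open W2" "p \<in> W2"
    using W W1 by (auto simp: W2_def)
  have L_TY: "L (z x - v *\<^sub>R e_last) = L (P x) / F x" for x
    by (simp add: z_def linear_cmul [OF linL])
  have LPp: "L (P p) = c * F p"
  proof -
    have "L (P p) / F p = c"
      using L_TY [of p] linear_cmul [OF linL] by (simp add: zp assms(11) c_def)
    then show ?thesis
      using F_pos [OF W(2)] by (simp add: field_simps)
  qed
  have F_ge: "F x \<ge> L (P x) / c" if "x \<in> W2" for x
  proof -
    have x: "x \<in> W" "z x \<in> N"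
      using that W1 by (auto simp: W2_def)
    moreover have "z x \<in> zero_set \<psi>"
      using T_zero [OF x(1)] TY [of x] by (simp add: zero_set_def z_def)
    ultimately have "L (z x - Z) \<le> 0"
      using N(3) by blast
    moreover have "L (z x - Z) = L (z x - v *\<^sub>R e_last) - L (z p - v *\<^sub>R e_last)"
      by (simp add: zp linear_diff [OF linL])
    ultimately have "L (P x) / F x \<le> L (P p) / F p"
      by (simp only: L_TY)
    then have "L (P x) / F x \<le> c"
      using F_pos [OF W(2)] by (simp add: LPp)
    then show ?thesis
      using F_pos [OF x(1)] c by (simp add: field_simps)
  qed

  \<comment> \<open>First derivative of \<open>F - L P / c\<close>. The horizontal part of
    \<open>P\<close> is linear, so its contribution here does not depend on \<open>x\<close> and
    disappears in the second derivative \<open>EG\<close>; what survives of \<open>L P\<close> is a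
    multiple of \<open>q\<close>.\<close>
  define DG where "DG x u = DF x u - (L ((- (1 - \<kappa>\<^sup>2)) *\<^sub>R u, 0) + \<kappa> * Dq x u * L e_last) / c"
    for x u
  have LP: "L (P x) = L ((- (1 - \<kappa>\<^sup>2)) *\<^sub>R x, 0) + (v + \<kappa> * q x) * L e_last" for x
  proof -
    have "P x = ((- (1 - \<kappa>\<^sup>2)) *\<^sub>R x, 0) + (v + \<kappa> * q x) *\<^sub>R e_last"
      by (simp add: P_def)
    then have "L (P x) = L ((- (1 - \<kappa>\<^sup>2)) *\<^sub>R x, 0) + L ((v + \<kappa> * q x) *\<^sub>R e_last)"
      by (simp only: linear_add [OF linL])
    then show ?thesis
      by (simp only: linear_cmul [OF linL] real_scaleR_def)
  qed
  have "bounded_linear (\<lambda>x. L ((- (1 - \<kappa>\<^sup>2)) *\<^sub>R x, 0))"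
    by (intro bounded_linear_compose [OF has_derivative_bounded_linear [OF L]]
        bounded_linear_Pair bounded_linear_scaleR_right bounded_linear_zero)
  then have DL: "((\<lambda>x. L ((- (1 - \<kappa>\<^sup>2)) *\<^sub>R x, 0)) has_derivative
      (\<lambda>x. L ((- (1 - \<kappa>\<^sup>2)) *\<^sub>R x, 0))) (at x)" for x
    by (rule bounded_linear_imp_has_derivative)
  define EG where "EG h = EF \<eta> h - \<kappa> * Eq \<eta> h * L e_last / c" for h
  \<comment> \<open>By \<open>F_ge\<close> and \<open>LPp\<close> the function
    \<open>F - L P / c\<close> is nonnegative on \<open>W2\<close> and vanishes at
    \<open>p\<close>.\<close>
  have "EG \<eta> \<ge> 0"
  proof (rule second_derivative_nonneg_at_min [OF W2])
    show "((\<lambda>x. F x - L (P x) / c) has_derivative DG x) (at x)" if "x \<in> W2" for x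
      unfolding LP DG_def [abs_def]
      by (rule derivative_eq_intros refl DF DL Dq | use that c in \<open>simp add: W2_def\<close>)+
    show "((\<lambda>x. DG x \<eta>) has_derivative EG) (at p)"
      unfolding DG_def EG_def [abs_def]
      by (rule derivative_eq_intros refl EF Eq | use c in simp)+
    show "F p - L (P p) / c \<le> F x - L (P x) / c" if "x \<in> W2" for x
      using F_ge [OF that] c by (simp add: LPp)
  qed
  \<comment> \<open>Here \<open>L e_last\<close> is the last partial derivative of
    \<open>\<psi>\<close> at \<open>Z\<close>; its positivity upgrades the weak inequality from
    concavity to a strict one.\<close>
  moreover have "\<kappa> * Eq \<eta> \<eta> * L e_last / c > 0"
    using \<kappa>v Eq_pos Le c by simp
  ultimately have EF_pos: "EF \<eta> \<eta> > 0"
    by (simp add: EG_def)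

  \<comment> \<open>The two coefficients of \<open>H_mat\<close> are independent of \<open>l\<close>
    and \<open>m\<close>, so the form is \<open>C1\<close> times the second derivative of
    \<open>F\<close> plus \<open>C2\<close> times that of \<open>q\<close>. Both are negative
    because \<open>\<kappa> < 1\<close>.\<close>
  define C1 where "C1 = v * (norm \<xi>)\<^sup>2 / (\<kappa>\<^sup>2 - 1) - (p \<bullet> \<xi>)\<^sup>2 / v"
  define C2 where "C2 = \<kappa> * (norm \<xi>)\<^sup>2 / (\<kappa>\<^sup>2 - 1)"
  have gap: "\<kappa>\<^sup>2 - 1 < 0"
    using refraction_index_gap_pos [OF \<kappa>v] by simp
  have "v * (norm \<xi>)\<^sup>2 / (\<kappa>\<^sup>2 - 1) < 0" "(p \<bullet> \<xi>)\<^sup>2 / v \<ge> 0"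
    using \<kappa>v \<xi> gap by (auto simp: divide_pos_neg)
  then have C1: "C1 < 0"
    by (simp add: C1_def)
  have C2: "C2 < 0"
    using \<kappa>v \<xi> gap by (auto simp: C2_def divide_pos_neg)
  have "(\<Sum>l\<in>UNIV. \<Sum>m\<in>UNIV. H_mat \<kappa> v T p \<xi> l m * \<eta> $ l * \<eta> $ m)
      = (\<Sum>l\<in>UNIV. \<Sum>m\<in>UNIV. C1 * (partial2 l m F p * \<eta> $ l * \<eta> $ m)
                            + C2 * (partial2 l m q p * \<eta> $ l * \<eta> $ m))"
    unfolding H_mat_def C1_def C2_def F_def [abs_def] w_def q_def by (simp add: algebra_simps)
  also have "\<dots> = C1 * EF \<eta> \<eta> + C2 * Eq \<eta> \<eta>"
    by (simp add: sum.distrib flip: sum_distrib_left partial2_quadratic_form [OF W DF EF]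
        partial2_quadratic_form [OF open_UNIV UNIV_I Dq Eq])
  also have "\<dots> < 0"
    using C1 C2 EF_pos Eq_pos by (simp add: add_neg_neg mult_neg_pos)
  finally show "(\<Sum>l\<in>UNIV. \<Sum>m\<in>UNIV. H_mat \<kappa> v T p \<xi> l m * (\<eta> $ l) * (\<eta> $ m)) < 0" .
qed

end
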